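(* For any $s,b\in\mathbb R$, the bilinear estimate $$\|u\,\partial_x^3v\|_{X^{s,b-1}_{\tau-n^5}}\le C\,\|u\|_{X^{s,b}_{\tau-n^5}}\|v\|_{X^{s,b}_{\tau-n^5}}$$ fails; that is, there is no constant $C>0$ for which it holds for all $u,v$.
   Context: Functions are defined on $\mathbb R\times\mathbb T$, $\mathbb T=[0,2\pi]$ with periodic boundary conditions. $\widetilde u(\tau,n)$, $(\tau,n)\in\mathbb R\times\mathbb Z$, is the Fourier transform in time and space, $\langle x\rangle=(1+|x|^2)^{1/2}$, and $$\|u\|_{X^{s,b}_{\tau-n^5}}=\big\|\langle\tau-n^5\rangle^b\langle n\rangle^s\,\widetilde u(\tau,n)\big\|_{L^2_\tau(\mathbb R;\ell^2_n(\mathbb Z))}.$$ *)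

theory Defs
  imports "HOL-Analysis.Analysis"
begin

text \<open>Functions on \<open>\<real> \<times> \<T>\<close> are rendered as curried functions \<open>u t x\<close> on \<open>\<real> \<times> \<real>\<close> that are
  \<open>2\<pi>\<close>-periodic in the space variable \<open>x\<close>.\<close>

definition dt :: "(real \<Rightarrow> real \<Rightarrow> complex) \<Rightarrow> real \<Rightarrow> real \<Rightarrow> complex" where
  "dt u = (\<lambda>t x. vector_derivative (\<lambda>t'. u t' x) (at t))"

definition dx :: "(real \<Rightarrow> real \<Rightarrow> complex) \<Rightarrow> real \<Rightarrow> real \<Rightarrow> complex" where
  "dx u = (\<lambda>t x. vector_derivative (\<lambda>x'. u t x') (at x))"

primrec C_k :: "nat \<Rightarrow> (real \<Rightarrow> real \<Rightarrow> complex) \<Rightarrow> bool" where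
  "C_k 0 u \<longleftrightarrow> continuous_on UNIV (\<lambda>(t, x). u t x)"
| "C_k (Suc k) u \<longleftrightarrow>
     (\<forall>t x. (\<lambda>t'. u t' x) differentiable (at t)) \<and>
     (\<forall>t x. (\<lambda>x'. u t x') differentiable (at x)) \<and>
     C_k k (dt u) \<and> C_k k (dx u)"

text \<open>The Schwartz class \<open>\<S>(\<real> \<times> \<T>)\<close>: the class on which the estimate is tested. It is
  contained in every \<open>X\<close>-space below, and both the product with a third derivative and the Fourier
  transform are classical on it, whatever the signs of \<open>s\<close> and \<open>b\<close>.\<close>

definition schwartz_RT :: "(real \<Rightarrow> real \<Rightarrow> complex) \<Rightarrow> bool" where
  "schwartz_RT u \<longleftrightarrow>
     (\<forall>t x. u t (x + 2 * pi) = u t x) \<and>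
     (\<forall>k. C_k k u) \<and>
     (\<forall>m j k. \<exists>B. \<forall>t x. (1 + \<bar>t\<bar>) ^ m * norm ((dx ^^ j) ((dt ^^ k) u) t x) \<le> B)"

definition spacetime_fourier :: "(real \<Rightarrow> real \<Rightarrow> complex) \<Rightarrow> real \<Rightarrow> int \<Rightarrow> complex" where
  "spacetime_fourier u \<tau> n =
     (LINT t|lborel. (LINT x:{0..2 * pi}|lborel.
        exp (- \<i> * complex_of_real (t * \<tau> + x * of_int n)) * u t x))"

definition bracket :: "real \<Rightarrow> real" where
  "bracket y = sqrt (1 + \<bar>y\<bar>\<^sup>2)"

definition ennreal_sqrt :: "ennreal \<Rightarrow> ennreal" where
  "ennreal_sqrt z = (if z = \<infinity> then \<infinity> else ennreal (sqrt (enn2real z)))"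

text \<open>The norm takes values in \<open>[0, \<infinity>]\<close>, so that no finiteness is presupposed.\<close>

definition X_norm :: "real \<Rightarrow> real \<Rightarrow> (real \<Rightarrow> real \<Rightarrow> complex) \<Rightarrow> ennreal" where
  "X_norm s b u =
     ennreal_sqrt (\<integral>\<^sup>+ \<tau>. (\<integral>\<^sup>+ n.
        ennreal ((bracket (\<tau> - of_int n ^ 5) powr b * bracket (of_int n) powr s
                  * norm (spacetime_fourier u \<tau> n))\<^sup>2)
        \<partial>count_space (UNIV :: int set)) \<partial>lborel)"

end

theory Submission
  imports Defs "HOL-Probability.Characteristic_Functions"
begin

text \<open>The zero mode is not excluded. If \<open>u\<close> is a function of time alone and
  \<open>v = \<phi>(t) exp (\<i> (N\<^sup>5 t + N x))\<close>, then \<open>u \<partial>\<^sub>x\<^sup>3 v\<close> is again concentrated on the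
  curve \<open>\<tau> = n\<^sup>5\<close> at frequency \<open>N\<close>: there is no modulation to compensate for the factor \<open>N\<^sup>3\<close>
  produced by the derivatives, and the weight \<open>\<langle>N\<rangle>\<^sup>s\<close> occurs once on each side. Gaussian profiles
  in time make all norms explicit, and \<open>N \<rightarrow> \<infinity>\<close> rules out every constant.\<close>

section \<open>Gaussian wave packets\<close>

text \<open>The polynomial prefactor makes the family closed under both partial derivatives, so
  regularity and decay of all derivatives reduce to bookkeeping on \<open>p\<close>. Norms are only
  computed for constant \<open>p\<close>.\<close>

definition packet :: "real \<Rightarrow> real \<Rightarrow> int \<Rightarrow> complex poly \<Rightarrow> real \<Rightarrow> real \<Rightarrow> complex" where
  "packet a M N p t x =
     poly p (of_real t) * exp (of_real (- (a * t\<^sup>2 / 2)) + \<i> * of_real (M * t + of_int N * x))"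

text \<open>The product rule in a complex variable, restricted to the real line. The linear
  polynomial \<open>[:\<i> * of_real M, - of_real a:]\<close> is the derivative of the
  exponent.\<close>

lemma packet_has_vector_derivative_t:
  "((\<lambda>t. packet a M N p t x) has_vector_derivative
     packet a M N (pderiv p + [:\<i> * of_real M, - of_real a:] * p) t x) (at t)"
proof -
  have "((\<lambda>z. poly p z * exp (- (of_real a * z\<^sup>2 / 2) + \<i> * (of_real M * z + of_int N * of_real x)))
      has_field_derivative packet a M N (pderiv p + [:\<i> * of_real M, - of_real a:] * p) t x)
      (at (of_real t))"
    by (auto intro!: derivative_eq_intros poly_DERIV simp: packet_def algebra_simps power2_eq_square)
  from has_vector_derivative_real_field[OF this]
  show ?thesis by (simp add: packet_def)
qed

lemma packet_has_vector_derivative_x: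
  "((\<lambda>x. packet a M N p t x) has_vector_derivative packet a M N (smult (\<i> * of_int N) p) t x) (at x)"
proof -
  have "((\<lambda>z. poly p (of_real t) * exp (of_real (- (a * t\<^sup>2 / 2)) + \<i> * (of_real (M * t) + of_int N * z)))
      has_field_derivative packet a M N (smult (\<i> * of_int N) p) t x) (at (of_real x))"
    by (auto intro!: derivative_eq_intros simp: packet_def algebra_simps)
  from has_vector_derivative_real_field[OF this]
  show ?thesis by (simp add: packet_def)
qed

lemma dt_packet:
  "dt (packet a M N p) = packet a M N (pderiv p + [:\<i> * of_real M, - of_real a:] * p)"
  unfolding dt_def
  by (intro ext vector_derivative_at packet_has_vector_derivative_t)

lemma dx_packet: "dx (packet a M N p) = packet a M N (smult (\<i> * of_int N) p)"
  unfolding dx_def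
  by (intro ext vector_derivative_at packet_has_vector_derivative_x)

lemma dx_funpow_packet: "(dx ^^ j) (packet a M N p) = packet a M N (smult ((\<i> * of_int N) ^ j) p)"
  by (induction j) (simp_all add: dx_packet)

lemma dt_funpow_packet: "\<exists>q. (dt ^^ k) (packet a M N p) = packet a M N q"
proof (induction k)
  case 0
  then show ?case by auto
next
  case (Suc k)
  then obtain q where "(dt ^^ k) (packet a M N p) = packet a M N q" ..
  then show ?case by (auto simp: dt_packet)
qed

lemma C_k_packet: "C_k k (packet a M N p)"
\<comment> \<open>\<open>p\<close> must vary, since each derivative is a packet with another
  polynomial.\<close>
proof (induction k arbitrary: p)
  case 0
  show ?case
    by (auto simp: packet_def split_def intro!: continuous_intros)
next
  case (Suc k)
  have "(\<lambda>t. packet a M N p t x) differentiable (at t)"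
    "(\<lambda>x. packet a M N p t x) differentiable (at x)" for t x
    using packet_has_vector_derivative_t packet_has_vector_derivative_x
    by (metis differentiableI_vector)+
  then show ?case
    by (simp add: dt_packet dx_packet Suc.IH)
qed

section \<open>Rapid decay of packets and membership in the Schwartz class\<close>

lemma poly_norm_bound:
  fixes p :: "complex poly"
  obtains A d where "A \<ge> 0" "\<And>z. norm (poly p z) \<le> A * (1 + norm z) ^ d"
proof (induction p arbitrary: thesis)
  case 0
  show ?case by (rule 0[of 0 0]) auto
next
  case (pCons c p)
  obtain A d where Ad: "A \<ge> 0" "\<And>z. norm (poly p z) \<le> A * (1 + norm z) ^ d"
    using pCons.IH by blast
  show ?case
  proof (rule pCons.prems)
    show "norm c + A \<ge> 0" using Ad by simp
    fix z :: complex
    \<comment> \<open>Horner's form c + z p(z): both terms are absorbed by one more power of 1 +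
      |z|.\<close>
    have "norm (poly (pCons c p) z) \<le> norm c + norm z * norm (poly p z)"
      by (simp add: norm_triangle_le norm_mult)
    also have "\<dots> \<le> norm c * (1 + norm z) ^ Suc d + (1 + norm z) * (A * (1 + norm z) ^ d)"
      using Ad by (intro add_mono mult_mono) (auto intro: mult_left_le simp del: power_Suc
        simp: mult_le_cancel_left1)
    also have "\<dots> = (norm c + A) * (1 + norm z) ^ Suc d"
      by (simp add: algebra_simps)
    finally show "norm (poly (pCons c p) z) \<le> (norm c + A) * (1 + norm z) ^ Suc d" .
  qed
qed

text \<open>From 1 + |t| \<le> exp |t| the power becomes exp (k |t|); completing the square in k |t|
  - e t^2 gives a bound independent of t.\<close>

lemma power_times_gaussian_bound:
  fixes e t :: real
  assumes "e > 0"
  shows "(1 + \<bar>t\<bar>) ^ k * exp (- (e * t\<^sup>2)) \<le> exp ((real k)\<^sup>2 / (4 * e))"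
proof -
  have "(1 + \<bar>t\<bar>) ^ k \<le> exp \<bar>t\<bar> ^ k"
    by (intro power_mono) auto
  then have "(1 + \<bar>t\<bar>) ^ k * exp (- (e * t\<^sup>2)) \<le> exp (real k * \<bar>t\<bar>) * exp (- (e * t\<^sup>2))"
    by (simp add: exp_of_nat_mult)
  also have "\<dots> = exp (real k * \<bar>t\<bar> - e * t\<^sup>2)"
    by (simp flip: exp_add)
  also have "real k * \<bar>t\<bar> - e * t\<^sup>2 \<le> (real k)\<^sup>2 / (4 * e)"
  proof -
    have "0 \<le> (real k - 2 * e * \<bar>t\<bar>)\<^sup>2" by simp
    then have "4 * e * (real k * \<bar>t\<bar>) - 4 * e * (e * t\<^sup>2) \<le> (real k)\<^sup>2"
      by (simp add: power2_diff power_mult_distrib power2_eq_square algebra_simps)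
    then show ?thesis using assms by (simp add: field_simps)
  qed
  then have "exp (real k * \<bar>t\<bar> - e * t\<^sup>2) \<le> exp ((real k)\<^sup>2 / (4 * e))" by simp
  finally show ?thesis .
qed

lemma packet_decay:
  assumes "a > 0"
  shows "\<exists>B. \<forall>t x. (1 + \<bar>t\<bar>) ^ m * norm (packet a M N p t x) \<le> B"
proof -
  obtain A d where Ad: "A \<ge> 0" "\<And>z. norm (poly p z) \<le> A * (1 + norm z) ^ d"
    using poly_norm_bound by blast
  have "(1 + \<bar>t\<bar>) ^ m * norm (packet a M N p t x) \<le> A * exp ((real (m + d))\<^sup>2 / (4 * (a / 2)))"
    for t x
  proof -
    have "(1 + \<bar>t\<bar>) ^ m * norm (packet a M N p t x)
        = (1 + \<bar>t\<bar>) ^ m * (norm (poly p (of_real t)) * exp (- (a / 2 * t\<^sup>2)))"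
      by (simp add: packet_def norm_mult)
    also have "\<dots> \<le> (1 + \<bar>t\<bar>) ^ m * (A * (1 + \<bar>t\<bar>) ^ d * exp (- (a / 2 * t\<^sup>2)))"
      using Ad(2)[of "of_real t"] by (intro mult_left_mono mult_right_mono) auto
    also have "\<dots> = A * ((1 + \<bar>t\<bar>) ^ (m + d) * exp (- (a / 2 * t\<^sup>2)))"
      by (simp add: power_add)
    also have "\<dots> \<le> A * exp ((real (m + d))\<^sup>2 / (4 * (a / 2)))"
      using assms Ad(1) by (intro mult_left_mono power_times_gaussian_bound) auto
    finally show ?thesis .
  qed
  then show ?thesis by blast
qed

text \<open>All mixed derivatives are packets with the same \<open>a\<close>, so the decay bound
  applies to each; periodicity holds because the spatial frequency is an integer.\<close>

lemma schwartz_packet: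
  assumes "a > 0"
  shows "schwartz_RT (packet a M N p)"
  unfolding schwartz_RT_def
proof (intro conjI allI)
  fix t x
  have "exp (of_real (- (a * t\<^sup>2 / 2)) + \<i> * of_real (M * t + of_int N * (x + 2 * pi)))
      = exp (of_real (- (a * t\<^sup>2 / 2)) + \<i> * of_real (M * t + of_int N * x))
          * exp (2 * of_int N * of_real pi * \<i>)"
    unfolding exp_add[symmetric] by (rule arg_cong[of _ _ exp]) (simp add: algebra_simps)
  also have "exp (2 * of_int N * of_real pi * \<i>) = 1"
    using exp_integer_2pi[of "of_int N"] by simp
  finally show "packet a M N p t (x + 2 * pi) = packet a M N p t x"
    by (simp add: packet_def)
next
  show "C_k k (packet a M N p)" for k by (rule C_k_packet)
next
  fix m j k
  obtain q where "(dt ^^ k) (packet a M N p) = packet a M N q"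
    using dt_funpow_packet by blast
  then show "\<exists>B. \<forall>t x. (1 + \<bar>t\<bar>) ^ m * norm ((dx ^^ j) ((dt ^^ k) (packet a M N p)) t x) \<le> B"
    using packet_decay[OF assms] by (simp add: dx_funpow_packet)
qed

section \<open>Fourier transform and norm of a wave packet\<close>

lemma set_integral_exp_int:
  "(LINT x:{0..2 * pi}|lborel. exp (\<i> * of_real (of_int k * x))) = (if k = 0 then 2 * of_real pi else 0)"
proof (cases "k = 0")
  case True
  then show ?thesis by (simp add: set_lebesgue_integral_def scaleR_conv_of_real)
next
  case False
  let ?F = "\<lambda>x::real. exp (\<i> * of_real (of_int k * x)) / (\<i> * of_int k)"
  have "(?F has_vector_derivative exp (\<i> * of_real (of_int k * x))) (at x within {0..2 * pi})" for x
  proof -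
    have "((\<lambda>z. exp (c * z) / c) has_field_derivative exp (c * z)) (at z)" if "c \<noteq> 0" for c z :: complex
      using that by (auto intro!: derivative_eq_intros)
    from this[of "\<i> * of_int k" "of_real x"]
    have "((\<lambda>z. exp (\<i> * of_int k * z) / (\<i> * of_int k)) has_field_derivative
        exp (\<i> * of_real (of_int k * x))) (at (of_real x))"
      using False by (simp add: mult.assoc)
    from has_vector_derivative_real_field[OF this]
    show ?thesis by (simp add: has_vector_derivative_at_within mult.assoc)
  qed
  then have "(LINT x:{0..2 * pi}|lborel. exp (\<i> * of_real (of_int k * x))) = ?F (2 * pi) - ?F 0"
    unfolding set_lebesgue_integral_def
    by (intro integral_FTC_atLeastAtMost) (auto intro!: continuous_intros)
  also have "exp (\<i> * of_real (of_int k * (2 * pi))) = exp (2 * of_int k * of_real pi * \<i>)"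
    by (simp add: algebra_simps)
  also have "\<dots> = 1" using exp_integer_2pi[of "of_int k"] by simp
  finally show ?thesis using False by simp
qed

text \<open>For a = 1 this is the characteristic function of the standard normal law with its
  normalisation removed; substituting t / sqrt a for t gives the general case.\<close>

lemma integral_gaussian_iexp:
  assumes "a > 0"
  shows "(LINT t|lborel. exp (of_real (- (a * t\<^sup>2 / 2)) + \<i> * of_real (\<theta> * t)))
    = of_real (sqrt (2 * pi / a) * exp (- (\<theta>\<^sup>2 / (2 * a))))"
proof -
  have std: "(LINT t|lborel. exp (of_real (- (t\<^sup>2 / 2)) + \<i> * of_real (\<theta> * t)))
      = of_real (sqrt (2 * pi) * exp (- (\<theta>\<^sup>2 / 2)))" for \<theta>
  proof -
    have "of_real (exp (- (\<theta>\<^sup>2 / 2))) = char std_normal_distribution \<theta>"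
      by (simp add: char_std_normal_distribution)
    also have "\<dots> = (LINT t|lborel. std_normal_density t *\<^sub>R iexp (\<theta> * t))"
      unfolding char_def by (subst integral_density) auto
    also have "\<dots> = (LINT t|lborel. of_real (1 / sqrt (2 * pi)) *
        exp (of_real (- (t\<^sup>2 / 2)) + \<i> * of_real (\<theta> * t)))"
      by (intro Bochner_Integration.integral_cong refl,
          simp only: std_normal_density_def scaleR_conv_of_real exp_add exp_of_real of_real_mult mult.assoc)
        (simp del: of_real_minus of_real_mult of_real_divide of_real_power)
    also have "\<dots> = of_real (1 / sqrt (2 * pi)) *
        (LINT t|lborel. exp (of_real (- (t\<^sup>2 / 2)) + \<i> * of_real (\<theta> * t)))"
      by (rule integral_mult_right_zero)
    finally show ?thesis by (simp add: field_simps flip: of_real_mult)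
  qed
  have "(LINT t|lborel. exp (of_real (- (a * t\<^sup>2 / 2)) + \<i> * of_real (\<theta> * t)))
      = \<bar>1 / sqrt a\<bar> *\<^sub>R (LINT t|lborel. exp (of_real (- (a * (0 + 1 / sqrt a * t)\<^sup>2 / 2))
          + \<i> * of_real (\<theta> * (0 + 1 / sqrt a * t))))"
    using assms by (intro lborel_integral_real_affine) auto
  also have "\<dots> = \<bar>1 / sqrt a\<bar> *\<^sub>R (LINT t|lborel. exp (of_real (- (t\<^sup>2 / 2))
          + \<i> * of_real (\<theta> / sqrt a * t)))"
    using assms by (simp add: power_divide)
  also have "\<dots> = of_real (sqrt (2 * pi / a) * exp (- (\<theta>\<^sup>2 / (2 * a))))"
    using assms unfolding std
    by (simp add: scaleR_conv_of_real power_divide real_sqrt_divide real_sqrt_mult mult.commute)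
  finally show ?thesis .
qed

lemma spacetime_fourier_packet:
  assumes "a > 0"
  shows "spacetime_fourier (packet a M N [:c:]) \<tau> n =
    (if n = N then c * of_real (2 * pi * sqrt (2 * pi / a) * exp (- ((\<tau> - M)\<^sup>2 / (2 * a)))) else 0)"
proof -
  have "(LINT x:{0..2 * pi}|lborel. exp (- \<i> * complex_of_real (t * \<tau> + x * of_int n))
          * packet a M N [:c:] t x)
      = c * (if n = N then 2 * of_real pi else 0)
          * exp (of_real (- (a * t\<^sup>2 / 2)) + \<i> * of_real ((M - \<tau>) * t))" for t
  proof -
    \<comment> \<open>The phases combine and separate: frequency M - \<tau> in time, N - n in space.
      Orthogonality of the exponentials then leaves only n = N.\<close>
    have "exp (- \<i> * complex_of_real (t * \<tau> + x * of_int n)) * packet a M N [:c:] t x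
        = (c * exp (of_real (- (a * t\<^sup>2 / 2)) + \<i> * of_real ((M - \<tau>) * t)))
            * exp (\<i> * of_real (of_int (N - n) * x))" for x
      by (simp add: packet_def algebra_simps flip: exp_add)
    then have "(LINT x:{0..2 * pi}|lborel. exp (- \<i> * complex_of_real (t * \<tau> + x * of_int n))
          * packet a M N [:c:] t x) = (c * exp (of_real (- (a * t\<^sup>2 / 2)) + \<i> * of_real ((M - \<tau>) * t)))
            * (LINT x:{0..2 * pi}|lborel. exp (\<i> * of_real (of_int (N - n) * x)))"
      by (simp only: set_integral_mult_right)
    then show ?thesis unfolding set_integral_exp_int by auto
  qed
  then have "spacetime_fourier (packet a M N [:c:]) \<tau> n
      = c * (if n = N then 2 * of_real pi else 0)
          * (LINT t|lborel. exp (of_real (- (a * t\<^sup>2 / 2)) + \<i> * of_real ((M - \<tau>) * t)))"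
    unfolding spacetime_fourier_def by (simp only: integral_mult_right_zero)
  also have "(M - \<tau>)\<^sup>2 = (\<tau> - M)\<^sup>2" by (rule power2_commute)
  ultimately show ?thesis
    unfolding integral_gaussian_iexp[OF assms] by simp
qed

section \<open>Weights and the norm of a packet on the curve\<close>

lemma bracket_ge_1: "bracket y \<ge> 1"
  by (simp add: bracket_def)

text \<open>The bracket is at least 1, so raising the exponent from b to m increases the power, even
  for negative b.\<close>

lemma bracket_powr_le:
  assumes "\<bar>b\<bar> \<le> real m"
  shows "bracket y powr b \<le> (1 + \<bar>y\<bar>) ^ m"
proof -
  have "bracket y \<le> 1 + \<bar>y\<bar>"
    unfolding bracket_def by (rule real_le_lsqrt) (auto simp: power2_eq_square algebra_simps)
  moreover have "bracket y powr b \<le> bracket y powr real m"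
    using assms bracket_ge_1 by (intro powr_mono) auto
  moreover have "bracket y powr real m = bracket y ^ m"
    using bracket_ge_1[of y] by (intro powr_realpow) linarith
  moreover have "bracket y ^ m \<le> (1 + \<bar>y\<bar>) ^ m"
    using calculation(1) bracket_ge_1[of y] by (intro power_mono) linarith+
  ultimately show ?thesis by linarith
qed

lemma borel_measurable_bracket [measurable]: "bracket \<in> borel_measurable borel"
  unfolding bracket_def[abs_def] by measurable

text \<open>Finiteness comes from domination by a normal density, positivity from a strictly
  positive integrand. Both matter: \<open>K\<close> serves as a real constant that can be divided
  by.\<close>

lemma weighted_gaussian_nn_integral:
  assumes "a > 0"
  obtains K where "K > 0"
    "(\<integral>\<^sup>+\<tau>. ennreal ((bracket \<tau> powr b * exp (- (\<tau>\<^sup>2 / (2 * a))))\<^sup>2) \<partial>lborel) = ennreal K"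
proof -
  let ?f = "\<lambda>\<tau>. (bracket \<tau> powr b * exp (- (\<tau>\<^sup>2 / (2 * a))))\<^sup>2"
  obtain m :: nat where m: "\<bar>b\<bar> \<le> real m" using real_arch_simple by blast
  \<comment> \<open>The first factor is the squared bound on polynomial weight times half of the
    Gaussian exponent; the square root cancels the normalisation of the normal density of variance
    a.\<close>
  define B where "B = (exp ((real m)\<^sup>2 / (4 * (1 / (4 * a)))))\<^sup>2 * sqrt (2 * pi * (sqrt a)\<^sup>2)"
  have bound: "?f \<tau> \<le> B * normal_density 0 (sqrt a) \<tau>" for \<tau>
  proof -
    have "bracket \<tau> powr b * exp (- (\<tau>\<^sup>2 / (2 * a)))
        \<le> (1 + \<bar>\<tau>\<bar>) ^ m * exp (- (\<tau>\<^sup>2 / (2 * a)))"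
      using bracket_powr_le[OF m] by (intro mult_right_mono) auto
    \<comment> \<open>The Gaussian is split into two equal factors: one absorbs the weight, the
      square of the other is the density up to normalisation.\<close>
    also have "\<dots> = (1 + \<bar>\<tau>\<bar>) ^ m * exp (- (1 / (4 * a) * \<tau>\<^sup>2)) * exp (- (\<tau>\<^sup>2 / (4 * a)))"
      using assms by (simp add: field_simps flip: exp_add)
    also have "\<dots> \<le> exp ((real m)\<^sup>2 / (4 * (1 / (4 * a)))) * exp (- (\<tau>\<^sup>2 / (4 * a)))"
      using assms by (intro mult_right_mono power_times_gaussian_bound) auto
    finally have "?f \<tau> \<le> (exp ((real m)\<^sup>2 / (4 * (1 / (4 * a)))) * exp (- (\<tau>\<^sup>2 / (4 * a))))\<^sup>2"
      by (intro power_mono) auto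
    also have "\<dots> = B * normal_density 0 (sqrt a) \<tau>"
      using assms by (simp add: B_def normal_density_def power_mult_distrib flip: exp_double)
    finally show ?thesis .
  qed
  have int: "integrable lborel ?f"
  proof (rule Bochner_Integration.integrable_bound)
    show "integrable lborel (\<lambda>\<tau>. B * normal_density 0 (sqrt a) \<tau>)" using assms by simp
    show "AE \<tau> in lborel. norm (?f \<tau>) \<le> norm (B * normal_density 0 (sqrt a) \<tau>)"
      using bound by (intro AE_I2) (smt (verit) real_norm_def zero_le_power2)
  qed measurable
  have pos: "?f \<tau> > 0" for \<tau>
    using bracket_ge_1[of \<tau>] by simp
  have "integral\<^sup>L lborel ?f \<noteq> 0"
  proof
    assume "integral\<^sup>L lborel ?f = 0"
    then have "AE \<tau> in lborel. ?f \<tau> = 0"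
      using integral_nonneg_eq_0_iff_AE[OF int] by simp
    then have "AE \<tau>::real in lborel. False"
      by (simp only: less_imp_neq[OF pos, symmetric])
    then show False by (simp add: AE_iff_measurable[OF _ refl])
  qed
  moreover have "integral\<^sup>L lborel ?f \<ge> 0" by simp
  ultimately have "integral\<^sup>L lborel ?f > 0" by linarith
  then show thesis
    using that nn_integral_eq_integral[OF int] by simp
qed

text \<open>With temporal frequency N^5 the transform is centred on the curve, so translating \<tau>
  by N^5 removes N from the modulation weight. Hence \<open>K\<close> is fixed before
  \<open>N\<close> and \<open>c\<close>, which lets N tend to infinity later.\<close>

lemma X_norm_packet:
  assumes "a > 0"
  obtains K where "K > 0"
    "\<And>N c. X_norm s b (packet a (of_int N ^ 5) N [:c:])
       = ennreal (norm c * bracket (of_int N) powr s * K)"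
proof -
  let ?g = "\<lambda>\<tau>. ennreal ((bracket \<tau> powr b * exp (- (\<tau>\<^sup>2 / (2 * a))))\<^sup>2)"
  obtain K where K: "K > 0" "(\<integral>\<^sup>+\<tau>. ?g \<tau> \<partial>lborel) = ennreal K"
    using weighted_gaussian_nn_integral[OF assms] by blast
  define A where "A = 2 * pi * sqrt (2 * pi / a)"
  have A: "A > 0" using assms by (simp add: A_def)
  have "X_norm s b (packet a (of_int N ^ 5) N [:c:])
      = ennreal (norm c * bracket (of_int N) powr s * (A * sqrt K))" for N c
  proof -
    define L where "L = norm c * bracket (of_int N) powr s * A"
    have L: "L \<ge> 0" using A by (simp add: L_def)
    have "(\<integral>\<^sup>+ n. ennreal ((bracket (\<tau> - of_int n ^ 5) powr b * bracket (of_int n) powr s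
          * norm (spacetime_fourier (packet a (of_int N ^ 5) N [:c:]) \<tau> n))\<^sup>2)
          \<partial>count_space (UNIV :: int set)) = ennreal (L\<^sup>2) * ?g (\<tau> - of_int N ^ 5)" for \<tau>
    \<comment> \<open>The sum over n collapses to the single term n = N, evaluated in case
      4.\<close>
    proof (subst nn_integral_count_space'[where A="{N}"], goal_cases)
      case 4
      have "norm (spacetime_fourier (packet a (of_int N ^ 5) N [:c:]) \<tau> N)
          = norm c * A * exp (- ((\<tau> - of_int N ^ 5)\<^sup>2 / (2 * a)))"
        using A assms unfolding spacetime_fourier_packet[OF assms] A_def
        by (simp add: norm_mult abs_mult del: of_real_mult)
      then show ?case
        by (simp add: L_def power_mult_distrib mult_ac flip: ennreal_mult)
    qed (auto simp: spacetime_fourier_packet[OF assms])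
    then have "X_norm s b (packet a (of_int N ^ 5) N [:c:])
        = ennreal_sqrt (\<integral>\<^sup>+\<tau>. ennreal (L\<^sup>2) * ?g (\<tau> - of_int N ^ 5) \<partial>lborel)"
      unfolding X_norm_def by simp
    also have "(\<integral>\<^sup>+\<tau>. ennreal (L\<^sup>2) * ?g (\<tau> - of_int N ^ 5) \<partial>lborel)
        = ennreal (L\<^sup>2) * (\<integral>\<^sup>+\<tau>. ?g (\<tau> - of_int N ^ 5) \<partial>lborel)"
      by (rule nn_integral_cmult) measurable
    \<comment> \<open>Translation invariance of Lebesgue measure.\<close>
    also have "(\<integral>\<^sup>+\<tau>. ?g (\<tau> - of_int N ^ 5) \<partial>lborel) = (\<integral>\<^sup>+\<tau>. ?g \<tau> \<partial>lborel)"
      using nn_integral_real_affine[of ?g 1 "- (of_int N ^ 5)"] by simp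
    also have "ennreal (L\<^sup>2) * \<dots> = ennreal (L\<^sup>2 * K)"
      using K by (simp add: ennreal_mult)
    also have "ennreal_sqrt \<dots> = ennreal (L * sqrt K)"
      using K L by (simp add: ennreal_sqrt_def real_sqrt_mult)
    finally show ?thesis by (simp add: L_def mult_ac)
  qed
  moreover have "A * sqrt K > 0" using A K by simp
  ultimately show thesis using that by blast
qed

section \<open>The counterexample: zero mode times a mode of high frequency N\<close>

theorem theorem1p5:
  fixes s b :: real
  shows "\<not> (\<exists>C::real. C > 0 \<and>
           (\<forall>u v. schwartz_RT u \<longrightarrow> schwartz_RT v \<longrightarrow>
              X_norm s (b - 1) (\<lambda>t x. u t x * (dx ^^ 3) v t x)
                \<le> ennreal C * X_norm s b u * X_norm s b v))"
proof (rule notI, elim exE conjE)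
  fix C :: real
  assume "C > 0" and est: "\<forall>u v. schwartz_RT u \<longrightarrow> schwartz_RT v \<longrightarrow>
              X_norm s (b - 1) (\<lambda>t x. u t x * (dx ^^ 3) v t x)
                \<le> ennreal C * X_norm s b u * X_norm s b v"
  obtain K where K: "K > 0" "\<And>N c. X_norm s b (packet 1 (of_int N ^ 5) N [:c:])
       = ennreal (norm c * bracket (of_int N) powr s * K)"
    using X_norm_packet[of 1] by auto
  \<comment> \<open>Parameter 2 because the product of two Gaussians with parameter 1 has parameter
    2.\<close>
  obtain K' where K': "K' > 0" "\<And>N c. X_norm s (b - 1) (packet 2 (of_int N ^ 5) N [:c:])
       = ennreal (norm c * bracket (of_int N) powr s * K')"
    using X_norm_packet[of 2] by auto
  \<comment> \<open>Chosen so that N K' > C K^2, with N \<ge> 1 to have N \<le> N^3.\<close>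
  define N where "N = \<lceil>C * K\<^sup>2 / K'\<rceil> + 1"
  have "C * K\<^sup>2 / K' > 0" using \<open>C > 0\<close> K(1) K'(1) by simp
  then have N: "of_int N > C * K\<^sup>2 / K'" "N \<ge> 1" unfolding N_def by linarith+
  define v where "v = packet 1 (of_int N ^ 5) N [:1:]"
  \<comment> \<open>The zero-mode factor contributes no phase, so the product stays at (N^5, N) on
    the curve, and the three derivatives give the coefficient (iN)^3 of modulus N^3.\<close>
  have "(\<lambda>t x. packet 1 (of_int 0 ^ 5) 0 [:1:] t x * (dx ^^ 3) v t x)
      = packet 2 (of_int N ^ 5) N [:(\<i> * of_int N) ^ 3:]"
    unfolding v_def dx_funpow_packet
    by (intro ext) (simp add: packet_def algebra_simps flip: exp_add)
  moreover have "schwartz_RT (packet 1 (of_int 0 ^ 5) 0 [:1:])" "schwartz_RT v"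
    unfolding v_def by (simp_all add: schwartz_packet)
  ultimately have "X_norm s (b - 1) (packet 2 (of_int N ^ 5) N [:(\<i> * of_int N) ^ 3:])
      \<le> ennreal C * X_norm s b (packet 1 (of_int 0 ^ 5) 0 [:1:]) * X_norm s b v"
    using est by metis
  moreover have "bracket (of_int 0) powr s = 1" by (simp add: bracket_def)
  ultimately have "ennreal (of_int N ^ 3 * bracket (of_int N) powr s * K')
      \<le> ennreal (C * K * (bracket (of_int N) powr s * K))"
    unfolding v_def K(2) K'(2) using \<open>C > 0\<close> K(1) N(2)
    by (simp add: norm_mult norm_power ennreal_mult)
  then have "of_int N ^ 3 * bracket (of_int N) powr s * K'
      \<le> C * K * (bracket (of_int N) powr s * K)"
    using \<open>C > 0\<close> K(1) by (subst (asm) ennreal_le_iff) auto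
  \<comment> \<open>The weight of frequency N occurs once on each side and cancels for every s,
    leaving N^3 K' \<le> C K^2.\<close>
  then have "bracket (of_int N) powr s * (of_int N ^ 3 * K') \<le> bracket (of_int N) powr s * (C * K\<^sup>2)"
    by (simp add: power2_eq_square mult_ac)
  moreover have "bracket (of_int N) powr s > 0" using bracket_ge_1[of "of_int N"] by simp
  ultimately have "of_int N ^ 3 * K' \<le> C * K\<^sup>2" by simp
  moreover have "(of_int N :: real) \<le> of_int N ^ 3"
    using N(2) by (intro self_le_power) auto
  then have "of_int N * K' \<le> of_int N ^ 3 * K'" using K'(1) by simp
  moreover have "of_int N * K' > C * K\<^sup>2" using N(1) K'(1) by (simp add: field_simps)
  ultimately show False by linarith
qed

end
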